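(* Let $V(z)=e^z-1$, with functional inverse $Z(v)=\log(1+v)$. Define polynomials $p_n$ and $q_n$ by $$e^{xZ(v)}=(1+v)^x=\sum_{n\ge0}\frac{v^n}{n!}\,p_n(x),\qquad e^{yV(z)}=e^{y(e^z-1)}=\sum_{n\ge0}\frac{z^n}{n!}\,q_n(y).$$ Then for all $n\ge0$, $$p_n(x)=x(x-1)\cdots(x-(n-1))=\sum_k s(n,k)\,x^k,$$ $$q_n(y)=\sum_k S(n,k)\,y^k=\mathcal{T}_n(y),$$ where $s(n,k)$ and $S(n,k)$ are the Stirling numbers of the first and second kinds, respectively, and $\mathcal{T}_n$ are the Touchard polynomials.
   Context: $s(n,k)$ are the signed Stirling numbers of the first kind: $(-1)^{n-k}s(n,k)$ is the number of permutations of $n$ elements with exactly $k$ cycles. $S(n,k)$ is the number of partitions of an $n$-element set into $k$ nonempty blocks. $\mathcal{T}_n(y)=\sum_k S(n,k)y^k$ is the $n$th Touchard polynomial. The generating function identities are expansions for small $v$ and $z$ (equivalently, as formal power series). *)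

theory Defs
  imports "HOL-Complex_Analysis.Complex_Analysis" "HOL-Combinatorics.Combinatorics"
begin

definition V :: "complex \<Rightarrow> complex" where
  "V z = exp z - 1"

definition Z :: "complex \<Rightarrow> complex" where
  "Z v = Ln (1 + v)"

text \<open>
  Exponential generating functions with a parameter: for every fixed \<open>x\<close>, the function
  \<open>f x\<close> has near \<open>0\<close> the expansion \<open>f x v = (\<Sum>n. v ^ n / fact n * poly (p n) x)\<close>.
\<close>

definition egf_of_polys :: "(complex \<Rightarrow> complex \<Rightarrow> complex) \<Rightarrow> (nat \<Rightarrow> complex poly) \<Rightarrow> bool" where
  "egf_of_polys f p \<longleftrightarrow>
     (\<forall>x. f x has_fps_expansion Abs_fps (\<lambda>n. poly (p n) x / fact n))"

text \<open>
  The Stirling numbers are defined by counting rather than by the recurrences underlying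
  \<^const>\<open>stirling\<close> and \<^const>\<open>Stirling\<close>. The cycles of a permutation of \<open>{..<n}\<close> are its orbits
  on that set, so fixed points count as cycles. The sign \<open>(-1) ^ (n + k)\<close> equals
  \<open>(-1) ^ (n - k)\<close> for \<open>k \<le> n\<close>; for \<open>k > n\<close> the number of permutations is zero.
\<close>

definition num_cycles :: "nat \<Rightarrow> (nat \<Rightarrow> nat) \<Rightarrow> nat" where
  "num_cycles n \<pi> = card (orbit \<pi> ` {..<n})"

definition stirling_first :: "nat \<Rightarrow> nat \<Rightarrow> int" where
  "stirling_first n k =
     (-1) ^ (n + k) * int (card {\<pi>. \<pi> permutes {..<n} \<and> num_cycles n \<pi> = k})"

definition stirling_second :: "nat \<Rightarrow> nat \<Rightarrow> nat" where
  "stirling_second n k = card {P. partition_on {..<n} P \<and> card P = k}"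

definition touchard :: "nat \<Rightarrow> complex poly" where
  "touchard n = (\<Sum>k\<le>n. monom (of_nat (stirling_second n k)) k)"

end

theory Submission
  imports Defs
begin

text \<open>
  Both counting definitions satisfy the triangle recurrences: a new element either forms its own
  cycle (block) or is spliced into an existing one. On the analytic side the coefficients of
  \<open>(1 + v) powr x\<close> are falling factorials by the binomial series, and the columns
  \<open>(e\<^sup>z - 1) ^ k / k!\<close> of \<open>exp (y * (e\<^sup>z - 1))\<close> satisfy
  \<open>F\<^sub>k' = k F\<^sub>k + F\<^bsub>k-1\<^esub>\<close>, which is the triangle recurrence of the second kind.
\<close>

section \<open>Counting set partitions\<close>

text \<open>Delete \<open>a\<close> from its block. If the block was \<open>{a}\<close>, it
  disappears and \<open>k\<close> blocks remain; otherwise the shrunken block \<open>B\<close> stays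
  nonempty, and the pair \<open>(Q, B)\<close> remembers where \<open>a\<close> has to be put
  back.\<close>

lemma partitions_insert:
  assumes "a \<notin> A" "finite A"
  shows "{P. partition_on (insert a A) P \<and> card P = Suc k} =
           insert {a} ` {Q. partition_on A Q \<and> card Q = k} \<union>
           (\<lambda>(Q, B). insert (insert a B) (Q - {B})) `
             (SIGMA Q : {Q. partition_on A Q \<and> card Q = Suc k}. Q)"
    (is "?L = ?R1 \<union> ?R2")
proof (intro equalityI subsetI)
  fix P assume "P \<in> ?L"
  hence P: "partition_on (insert a A) P" "card P = Suc k"
    by auto
  obtain C where C: "C \<in> P" "a \<in> C"
    using partition_onD1[OF P(1)] by blast
  define R where "R = P - {C}"
  have PR: "P = insert C R" "C \<notin> R"
    using C by (auto simp: R_def)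
  have finR: "finite R"
    using finite_elements[OF _ P(1)] assms by (simp add: R_def)
  have cardR: "card R = k"
    using P(2) PR finR by simp
  have "disjnt C (\<Union>R)"
    using partition_onD2[OF P(1)] C by (auto simp: R_def disjnt_def disjoint_def)
  hence R: "partition_on (insert a A - C) R" "C \<subseteq> insert a A"
    using P(1) partition_on_insert[of C R "insert a A"] unfolding PR(1) by auto
  show "P \<in> ?R1 \<union> ?R2"
  proof (cases "C = {a}")
    case True
    hence "partition_on A R"
      using R assms by simp
    thus ?thesis
      using True PR cardR by blast
  next
    case False
    define B where "B = C - {a}"
    have B: "C = insert a B" "a \<notin> B" "B \<noteq> {}" "B \<subseteq> A"
      using C False R(2) by (auto simp: B_def)
    have AB: "insert a A - C = A - B"
      using assms B by auto
    have dis: "disjnt B (\<Union>R)"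
      using \<open>disjnt C (\<Union>R)\<close> B by (auto simp: disjnt_def)
    have "B \<notin> R"
      using dis B(3) by (auto simp: disjnt_def)
    moreover have "partition_on A (insert B R)"
      using partition_on_insert[OF dis] R(1) B AB by simp
    moreover have "P = insert (insert a B) (insert B R - {B})"
      using PR B \<open>B \<notin> R\<close> by simp
    ultimately show ?thesis
      using cardR finR by (intro UnI2 rev_image_eqI[of "(insert B R, B)"]) auto
  qed
next
  fix P assume "P \<in> ?R1 \<union> ?R2"
  thus "P \<in> ?L"
  proof
    assume "P \<in> ?R1"
    then obtain Q where Q: "partition_on A Q" "card Q = k" "P = insert {a} Q"
      by auto
    have "\<Union>Q = A"
      using partition_onD1[OF Q(1)] by simp
    hence "disjnt {a} (\<Union>Q)" "{a} \<notin> Q"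
      using assms by (auto simp: disjnt_def)
    thus ?thesis
      using Q assms partition_on_insert[of "{a}" Q "insert a A"] finite_elements[OF _ Q(1)] by simp
  next
    assume "P \<in> ?R2"
    then obtain Q B where Q: "partition_on A Q" "card Q = Suc k" "B \<in> Q"
        and P: "P = insert (insert a B) (Q - {B})"
      by auto
    define R where "R = Q - {B}"
    have QR: "Q = insert B R" "B \<notin> R"
      using Q by (auto simp: R_def)
    have finR: "finite R"
      using finite_elements[OF _ Q(1)] assms by (simp add: R_def)
    have sub: "\<Union>Q = A"
      using partition_onD1[OF Q(1)] by simp
    have dis: "disjnt B (\<Union>R)"
      using partition_onD2[OF Q(1)] Q(3) by (auto simp: R_def disjnt_def disjoint_def)
    have R: "partition_on (A - B) R" "B \<subseteq> A"
      using Q(1) partition_on_insert[OF dis] unfolding QR(1) by auto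
    have dis': "disjnt (insert a B) (\<Union>R)"
      using dis sub assms by (auto simp: disjnt_def R_def)
    have "insert a A - insert a B = A - B"
      using assms by auto
    hence "partition_on (insert a A) P"
      using partition_on_insert[OF dis', of "insert a A"] R
      unfolding P R_def[symmetric] by auto
    moreover have "insert a B \<notin> R"
      using sub assms QR by auto
    hence "card P = Suc k"
      using Q(2) QR finR unfolding P R_def[symmetric] by simp
    ultimately show ?thesis
      by simp
  qed
qed

text \<open>Both ways of inserting \<open>a\<close> are injective and their results are disjoint.
  The factor \<open>Suc k\<close> is the number of blocks of \<open>Q\<close> that can receive
  \<open>a\<close>.\<close>

lemma card_partitions_insert:
  assumes "a \<notin> A" "finite A"
  shows "card {P. partition_on (insert a A) P \<and> card P = Suc k} =
           Suc k * card {P. partition_on A P \<and> card P = Suc k} +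
           card {P. partition_on A P \<and> card P = k}"
proof -
  let ?N = "\<lambda>k. {P. partition_on A P \<and> card P = k}"
  let ?g = "\<lambda>(Q, B). insert (insert a B) (Q - {B})"
  have fin: "finite (?N j)" for j
    by (rule finite_subset[OF _ finitely_many_partition_on[OF assms(2)]]) auto
  have finQ: "finite Q" if "Q \<in> ?N j" for Q j
    using finite_elements[OF assms(2)] that by auto
  have a: "a \<notin> B" if "Q \<in> ?N j" "B \<in> Q" for Q B j
    using that assms(1) partition_onD1 by fastforce
  have "inj_on (insert {a}) (?N k)"
  proof (rule inj_on_inverseI[where g = "\<lambda>P. P - {{a}}"])
    fix Q assume "Q \<in> ?N k"
    thus "insert {a} Q - {{a}} = Q"
      using a[of Q k "{a}"] by auto
  qed
  hence c1: "card (insert {a} ` ?N k) = card (?N k)"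
    by (rule card_image)
  \<comment> \<open>Removing \<open>a\<close> from every block recovers \<open>Q\<close>; the block
    that contains \<open>a\<close>, stripped of \<open>a\<close>, recovers \<open>B\<close>.\<close>
  have "inj_on ?g (SIGMA Q : ?N (Suc k). Q)"
  proof (rule inj_on_inverseI[where g = "\<lambda>P. ((\<lambda>X. X - {a}) ` P, \<Union>{X \<in> P. a \<in> X} - {a})"],
         clarify)
    fix Q B assume Q: "partition_on A Q" "card Q = Suc k" "B \<in> Q"
    have *: "a \<notin> X" if "X \<in> Q" for X
      using a[of Q "Suc k"] Q that by auto
    have "(\<lambda>X. X - {a}) ` (Q - {B}) = (\<lambda>X. X) ` (Q - {B})"
      using * by (intro image_cong) auto
    moreover have "insert a B - {a} = B"
      using * Q(3) by auto
    ultimately have "(\<lambda>X. X - {a}) ` insert (insert a B) (Q - {B}) = Q"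
      using Q(3) by (simp only: image_insert image_ident insert_Diff)
    moreover have "{X \<in> insert (insert a B) (Q - {B}). a \<in> X} = {insert a B}"
      using * by auto
    hence "\<Union>{X \<in> insert (insert a B) (Q - {B}). a \<in> X} - {a} = B"
      using * Q(3) by simp
    ultimately show "(\<lambda>X. X - {a}) ` insert (insert a B) (Q - {B}) = Q \<and>
            \<Union>{X \<in> insert (insert a B) (Q - {B}). a \<in> X} - {a} = B"
      by blast
  qed
  hence "card (?g ` (SIGMA Q : ?N (Suc k). Q)) = card (SIGMA Q : ?N (Suc k). Q)"
    by (rule card_image)
  also have "\<dots> = (\<Sum>Q\<in>?N (Suc k). card Q)"
    using fin finQ by (intro card_SigmaI) blast+
  also have "\<dots> = Suc k * card (?N (Suc k))"
    by simp
  finally have c2: "card (?g ` (SIGMA Q : ?N (Suc k). Q)) = Suc k * card (?N (Suc k))" .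
  \<comment> \<open>Disjointness of the two families: here \<open>a\<close> shares its block with
    the nonempty \<open>B\<close>.\<close>
  have "{a} \<notin> ?g (Q, B)" if "Q \<in> ?N (Suc k)" "B \<in> Q" for Q B
  proof -
    have "B \<noteq> {}"
      using that partition_onD3 by auto
    thus ?thesis
      using a[OF that(1)] that(2) by fastforce
  qed
  hence dis: "insert {a} ` ?N k \<inter> ?g ` (SIGMA Q : ?N (Suc k). Q) = {}"
    by fastforce
  have "finite (SIGMA Q : ?N (Suc k). Q)"
    using fin finQ by (intro finite_SigmaI) blast+
  thus ?thesis
    unfolding partitions_insert[OF assms]
    using c1 c2 dis fin by (subst card_Un_disjoint) auto
qed

lemma stirling_second_eq_Stirling: "stirling_second n k = Stirling n k"
proof (induction n k rule: Stirling.induct)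
  case 1
  have "{P. partition_on {..<0::nat} P \<and> card P = 0} = {{}}"
    by (auto simp: partition_on_empty)
  thus ?case
    by (simp add: stirling_second_def)
next
  case (2 k)
  have "{P. partition_on {..<0::nat} P \<and> card P = Suc k} = {}"
    by (auto simp: partition_on_empty)
  thus ?case
    by (simp only: stirling_second_def card.empty Stirling.simps)
next
  case (3 n)
  \<comment> \<open>A partition of a nonempty set has at least one block, which is the boundary
    value 0 in column 0.\<close>
  have "card P \<noteq> 0" if P: "partition_on {..<Suc n} P" for P
  proof -
    have "finite P"
      using finite_elements[OF _ P] by simp
    moreover have "P \<noteq> {}"
      using partition_onD1[OF P] by auto
    ultimately show ?thesis
      by simp
  qed
  hence "{P. partition_on {..<Suc n} P \<and> card P = 0} = {}"
    by auto
  thus ?case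
    by (simp only: stirling_second_def card.empty Stirling.simps)
next
  case (4 n k)
  thus ?case
    using card_partitions_insert[of n "{..<n}" k]
    by (simp add: stirling_second_def lessThan_Suc)
qed

section \<open>Counting permutations by cycles\<close>

text \<open>Composing with the transposition replaces each step of \<open>p\<close> into
  \<open>b\<close> by a detour through \<open>a\<close>, since the new map sends \<open>a\<close> to
  \<open>b\<close>. So \<open>a\<close> is spliced in just before \<open>b\<close>, and orbits that
  avoid \<open>b\<close> do not change.\<close>

lemma orbit_transpose_comp:
  assumes p: "p permutes S" and a: "a \<notin> S" and b: "b \<in> S" and x: "x \<in> S"
  shows "orbit (Transposition.transpose a b \<circ> p) x =
           (if b \<in> orbit p x then insert a (orbit p x) else orbit p x)"
proof -
  let ?q = "Transposition.transpose a b \<circ> p"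
  have pa: "p a = a"
    using p a by (rule permutes_not_in)
  have qa: "?q a = b"
    by (simp add: pa)
  have pS: "p y \<in> S" if "y \<in> S" for y
    using permutes_in_image[OF p] that by simp
  have q: "?q y = (if p y = b then a else p y)" if "y \<in> S" for y
    using pS[OF that] a by (auto simp: Transposition.transpose_def)
  have sub: "orbit p x \<subseteq> S"
    using permutes_orbit_subset[OF p x] .
  have 1: "y \<in> orbit p x \<or> y = a \<and> b \<in> orbit p x" if "y \<in> orbit ?q x" for y
    using that
  proof induction
    case base
    show ?case
      unfolding q[OF x] using orbit.base[of p x] by auto
  next
    case (step y)
    thus ?case
    proof (elim disjE)
      assume y: "y \<in> orbit p x"
      with sub have "y \<in> S"
        by blast
      from q[OF this] orbit.step[OF y] show ?case
        by auto
    qed (use qa in auto)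
  qed
  \<comment> \<open>The second conjunct records the detour: where \<open>p\<close> steps to
    \<open>b\<close>, \<open>?q\<close> first steps to \<open>a\<close>, and one further step
    reaches \<open>b\<close>.\<close>
  have 2: "y \<in> orbit ?q x \<and> (y = b \<longrightarrow> a \<in> orbit ?q x)" if "y \<in> orbit p x" for y
  proof -
    have *: "p z \<in> orbit ?q x \<and> (p z = b \<longrightarrow> a \<in> orbit ?q x)"
      if "z \<in> S" "?q z \<in> orbit ?q x" for z
      using q[OF that(1)] that(2) orbit.step[of a ?q x] unfolding qa by (auto split: if_splits)
    show ?thesis
      using that
    proof induction
      case base
      show ?case
        using *[OF x orbit.base] .
    next
      case (step y)
      hence "y \<in> S"
        using sub by blast
      thus ?case
        using *[of y] orbit.step[of y ?q x] step by blast
    qed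
  qed
  show ?thesis
    using 1 2 by auto
qed

text \<open>The point \<open>a\<close> is fixed by \<open>p\<close>, so its orbit \<open>{a}\<close>
  is new: all other orbits lie inside \<open>S\<close>.\<close>

lemma card_orbits_insert_fixpoint:
  assumes p: "p permutes S" and a: "a \<notin> S" and S: "finite S"
  shows "card (orbit p ` insert a S) = Suc (card (orbit p ` S))"
proof -
  have "orbit p a \<notin> orbit p ` S"
  proof
    assume "orbit p a \<in> orbit p ` S"
    then obtain x where "x \<in> S" "orbit p a = orbit p x"
      by blast
    moreover have "orbit p a = {a}"
      using orbit_eq_singleton_iff permutes_not_in[OF p a] by metis
    ultimately show False
      using permutes_orbit_subset[OF p, of x] a by auto
  qed
  thus ?thesis
    using S by simp
qed

text \<open>Splicing \<open>a\<close> into the cycle of \<open>b\<close> creates no cycle and merges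
  none: the old orbits are recovered by deleting \<open>a\<close>.\<close>

lemma card_orbits_transpose_comp:
  assumes p: "p permutes S" and a: "a \<notin> S" and b: "b \<in> S" and S: "finite S"
  shows "card (orbit (Transposition.transpose a b \<circ> p) ` insert a S) = card (orbit p ` S)"
proof -
  let ?q = "Transposition.transpose a b \<circ> p"
  let ?g = "\<lambda>X. if b \<in> X then insert a X else X"
  have "?q permutes insert a S"
    using p b by (intro permutes_compose permutes_swap_id) (auto intro: permutes_subset)
  hence "permutation ?q"
    using S permutation_permutes by (metis finite_insert)
  moreover have "?q a = b"
    by (simp add: permutes_not_in[OF p a])
  \<comment> \<open>A point and its image share an orbit under a permutation of finite support, so
    \<open>a\<close> contributes no orbit beyond that of \<open>b\<close>.\<close>
  ultimately have "orbit ?q a = orbit ?q b"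
    using permutation_orbit_step by metis
  hence "orbit ?q ` insert a S = orbit ?q ` S"
    using b by auto
  also have "\<dots> = ?g ` (orbit p ` S)"
    unfolding image_image using orbit_transpose_comp[OF p a b] by (intro image_cong) auto
  finally have "card (orbit ?q ` insert a S) = card (?g ` (orbit p ` S))"
    by simp
  also have "\<dots> = card (orbit p ` S)"
  proof (rule card_image, rule inj_on_inverseI[where g = "\<lambda>X. X - {a}"])
    fix X assume "X \<in> orbit p ` S"
    hence "a \<notin> X"
      using permutes_orbit_subset[OF p] a by blast
    thus "?g X - {a} = X"
      by auto
  qed
  finally show ?thesis .
qed

text \<open>Each permutation of \<open>insert a S\<close> is uniquely a transposition of
  \<open>a\<close> and \<open>b\<close> after a permutation \<open>p\<close> of \<open>S\<close>.
  The choice \<open>b = a\<close> adds a fixed point, hence a cycle; each of the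
  \<open>card S\<close> other choices keeps the number of cycles.\<close>

lemma card_permutations_insert:
  assumes a: "a \<notin> S" and S: "finite S"
  shows "card {p. p permutes insert a S \<and> card (orbit p ` insert a S) = Suc k} =
           card S * card {p. p permutes S \<and> card (orbit p ` S) = Suc k} +
           card {p. p permutes S \<and> card (orbit p ` S) = k}"
proof -
  let ?N = "\<lambda>k. {p. p permutes S \<and> card (orbit p ` S) = k}"
  let ?f = "\<lambda>(b, p). Transposition.transpose a b \<circ> p"
  let ?D = "S \<times> ?N (Suc k) \<union> {a} \<times> ?N k"
  have fin: "finite (?N j)" for j
    by (rule finite_subset[OF _ finite_permutations[OF S]]) auto
  have "card (orbit (Transposition.transpose a b \<circ> p) ` insert a S) =
          (if b = a then Suc (card (orbit p ` S)) else card (orbit p ` S))"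
    if "p permutes S" "b \<in> insert a S" for b p
    using that card_orbits_insert_fixpoint[OF that(1) a S]
      card_orbits_transpose_comp[OF that(1) a _ S, of b] by auto
  hence iff: "card (orbit (?f (b, p)) ` insert a S) = Suc k \<longleftrightarrow> (b, p) \<in> ?D"
    if "p permutes S" "b \<in> insert a S" for b p
    using that a by auto
  have "{p. p permutes insert a S \<and> card (orbit p ` insert a S) = Suc k} =
          {q \<in> ?f ` (insert a S \<times> {p. p permutes S}). card (orbit q ` insert a S) = Suc k}"
    using permutes_insert[of a S] by (auto simp: set_eq_iff)
  also have "\<dots> = ?f ` {bp \<in> insert a S \<times> {p. p permutes S}.
                          card (orbit (?f bp) ` insert a S) = Suc k}"
    by blast
  also have "{bp \<in> insert a S \<times> {p. p permutes S}. card (orbit (?f bp) ` insert a S) = Suc k} = ?D"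
    using iff by auto
  finally have "card {p. p permutes insert a S \<and> card (orbit p ` insert a S) = Suc k} =
                  card (?f ` ?D)"
    by (rule arg_cong)
  \<comment> \<open>As \<open>p\<close> fixes \<open>a\<close>, the composite sends \<open>a\<close>
    to \<open>b\<close>. This recovers \<open>b\<close>, and applying the same transposition again
    recovers \<open>p\<close>.\<close>
  also have "\<dots> = card ?D"
  proof (rule card_image, rule inj_on_inverseI[where g = "\<lambda>q. (q a, Transposition.transpose a (q a) \<circ> q)"])
    fix bp assume "bp \<in> ?D"
    then obtain b p where bp: "bp = (b, p)" "p permutes S"
      by auto
    have "p a = a"
      using permutes_not_in[OF bp(2) a] .
    thus "(?f bp a, Transposition.transpose a (?f bp a) \<circ> ?f bp) = bp"
      by (simp add: bp(1) fun_eq_iff)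
  qed
  also have "\<dots> = card (S \<times> ?N (Suc k)) + card ({a} \<times> ?N k)"
    using fin S a by (intro card_Un_disjoint finite_cartesian_product) auto
  finally show ?thesis
    by (simp add: card_cartesian_product)
qed

lemma stirling_first_eq_stirling: "stirling_first n k = (-1) ^ (n + k) * int (stirling n k)"
proof -
  have "card {\<pi>. \<pi> permutes {..<n} \<and> num_cycles n \<pi> = k} = stirling n k"
  proof (induction n k rule: stirling.induct)
    case 1
    have "{p. p permutes {..<0::nat} \<and> num_cycles 0 p = 0} = {id}"
      by (auto simp: num_cycles_def)
    thus ?case
      by simp
  next
    case (2 k)
    thus ?case
      by (simp add: num_cycles_def)
  next
    case (3 n)
    thus ?case
      by (simp add: num_cycles_def lessThan_Suc)
  next
    case (4 n k)
    thus ?case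
      using card_permutations_insert[of n "{..<n}" k]
      by (simp add: num_cycles_def lessThan_Suc)
  qed
  thus ?thesis
    by (simp add: stirling_first_def)
qed

text \<open>Moving the sign \<open>(-1) ^ k\<close> into the power gives the unsigned sum at
  \<open>-x\<close>, which is a rising factorial. The remaining \<open>(-1) ^ n\<close> flips each
  of its \<open>n\<close> factors and makes it a falling factorial at \<open>x\<close>.\<close>

lemma sum_stirling_first:
  fixes x :: complex
  shows "(\<Sum>k\<le>n. of_int (stirling_first n k) * x ^ k) = (\<Prod>j<n. x - of_nat j)"
proof -
  have "(\<Sum>k\<le>n. of_int (stirling_first n k) * x ^ k) =
          (-1) ^ n * (\<Sum>k\<le>n. of_nat (stirling n k) * (-x) ^ k)"
    unfolding sum_distrib_left
    by (intro sum.cong refl)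
       (simp add: stirling_first_eq_stirling power_add power_minus[of x] mult_ac)
  also have "\<dots> = (-1) ^ n * pochhammer (-x) n"
    by (simp only: stirling_pochhammer)
  also have "\<dots> = (\<Prod>j<n. (-1) * (-x + of_nat j))"
    by (simp only: pochhammer_prod prod.distrib prod_constant card_lessThan atLeast0LessThan)
  also have "\<dots> = (\<Prod>j<n. x - of_nat j)"
    by simp
  finally show ?thesis .
qed

section \<open>Generating functions\<close>

text \<open>Column \<open>k\<close> of the triangle has exponential generating function
  \<open>?V ^ k / fact k\<close>. The recurrence comes from differentiating \<open>?V ^ k\<close>
  and comparing coefficients.\<close>

lemma fps_exp_minus_1_power_nth:
  "((fps_exp 1 - 1) ^ k :: 'a :: field_char_0 fps) $ n = of_nat (Stirling n k) * fact k / fact n"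
proof (induction n arbitrary: k)
  case 0
  show ?case
    by (cases k) (simp_all add: fps_power_zeroth)
next
  case (Suc n)
  let ?V = "fps_exp 1 - 1 :: 'a fps"
  show ?case
  proof (cases k)
    case (Suc j)
    have "fps_deriv (?V ^ Suc j) = of_nat (Suc j) * fps_exp 1 * ?V ^ j"
      by (simp add: fps_deriv_power' del: of_nat_Suc power_Suc)
    \<comment> \<open>Writing the derivative \<open>fps_exp 1\<close> of \<open>?V\<close> as
      \<open>?V + 1\<close> leaves only powers of \<open>?V\<close>, to which the induction
      hypothesis applies.\<close>
    also have "\<dots> = of_nat (Suc j) * (?V ^ Suc j + ?V ^ j)"
      by (simp add: algebra_simps)
    finally have "fps_deriv (?V ^ Suc j) = of_nat (Suc j) * (?V ^ Suc j + ?V ^ j)" .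
    hence "fps_deriv (?V ^ Suc j) $ n = of_nat (Suc j) * ((?V ^ Suc j) $ n + (?V ^ j) $ n)"
      by (metis fps_add_nth fps_mult_left_const_nth fps_of_nat)
    hence "of_nat (Suc n) * (?V ^ Suc j) $ Suc n =
             of_nat (Suc j) * ((?V ^ Suc j) $ n + (?V ^ j) $ n)"
      by (simp only: fps_deriv_nth Suc_eq_plus1)
    also have "\<dots> = of_nat (Stirling (Suc n) (Suc j)) * fact (Suc j) / fact n"
      unfolding Suc.IH by (simp add: field_simps)
    finally show ?thesis
      unfolding Suc by (simp add: field_simps del: of_nat_Suc Stirling.simps power_Suc)
  qed simp
qed

text \<open>In the composition of power series, the term \<open>y ^ k / fact k\<close> meets the
  coefficient of \<open>z ^ n\<close> in the \<open>k\<close>-th power of the inner series, and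
  \<open>fact k\<close> cancels.\<close>

lemma V_egf_of_touchard: "egf_of_polys (\<lambda>y z. exp (y * V z)) touchard"
  unfolding egf_of_polys_def
proof
  fix y :: complex
  have "V has_fps_expansion fps_exp 1 - 1"
    unfolding V_def by (intro fps_expansion_intros)
  hence "(\<lambda>z. exp (y * V z)) has_fps_expansion (fps_exp y oo (fps_exp 1 - 1))"
    using has_fps_expansion_compose[OF has_fps_expansion_exp[of y], of V "fps_exp 1 - 1"]
    by (simp add: o_def)
  also have "fps_exp y oo (fps_exp 1 - 1) = Abs_fps (\<lambda>n. poly (touchard n) y / fact n)"
    by (rule fps_ext)
       (simp add: fps_compose_nth fps_exp_minus_1_power_nth touchard_def poly_sum poly_monom
          stirling_second_eq_Stirling sum_divide_distrib atLeast0AtMost mult.commute)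
  finally show "(\<lambda>z. exp (y * V z)) has_fps_expansion
                  Abs_fps (\<lambda>n. poly (touchard n) y / fact n)" .
qed

lemma eventually_near_minus_1: "\<forall>\<^sub>F v :: complex in nhds 0. 1 + v \<noteq> 0"
proof -
  have "\<forall>\<^sub>F v :: complex in nhds 0. v \<in> - {-1}"
    by (intro eventually_nhds_in_open) auto
  thus ?thesis
    by eventually_elim (auto simp: add_eq_0_iff)
qed

text \<open>At \<open>v = -1\<close> the two sides differ: \<open>powr\<close> has the default value
  0 at base 0, while \<open>exp\<close> never vanishes.\<close>

lemma eventually_exp_Z: "\<forall>\<^sub>F v in nhds 0. exp (x * Z v) = (1 + v) powr x"
  using eventually_near_minus_1 by eventually_elim (simp add: Z_def powr_def)

text \<open>The binomial series has coefficients \<open>x gchoose n\<close>, that is, falling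
  factorials divided by \<open>fact n\<close>.\<close>

lemma Z_egf_of_falling_factorials:
  "egf_of_polys (\<lambda>x v. exp (x * Z v)) (\<lambda>n. \<Prod>j<n. [:- of_nat j, 1:])"
  unfolding egf_of_polys_def
proof
  fix x :: complex
  have "fps_binomial x = Abs_fps (\<lambda>n. poly (\<Prod>j<n. [:- of_nat j, 1:]) x / fact n)"
    by (rule fps_ext) (simp add: gbinomial_prod_rev poly_prod atLeast0LessThan)
  thus "(\<lambda>v. exp (x * Z v)) has_fps_expansion
          Abs_fps (\<lambda>n. poly (\<Prod>j<n. [:- of_nat j, 1:]) x / fact n)"
    using has_fps_expansion_cong[OF eventually_exp_Z refl] has_fps_expansion_binomial_complex
    by metis
qed

text \<open>For each fixed \<open>x\<close> the expansion at 0 is unique, so the polynomials agree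
  at every complex number and are therefore equal. This transfers facts about one explicit sequence
  to any sequence with the same generating function.\<close>

lemma egf_of_polys_unique:
  assumes "egf_of_polys f p" "egf_of_polys f q"
  shows "p = q"
proof
  fix n
  have "poly (p n) x = poly (q n) x" for x
  proof -
    have "Abs_fps (\<lambda>n. poly (p n) x / fact n) = Abs_fps (\<lambda>n. poly (q n) x / fact n)"
      using assms unfolding egf_of_polys_def by (blast intro: fps_expansion_unique_complex)
    from arg_cong[OF this, of "\<lambda>F. F $ n"] show ?thesis
      by simp
  qed
  thus "p n = q n"
    by (simp add: poly_eq_poly_eq_iff[symmetric] fun_eq_iff)
qed

lemma eventually_Z_V: "\<forall>\<^sub>F z in nhds 0. Z (V z) = z"
proof -
  \<comment> \<open>The radius \<open>pi\<close> keeps the imaginary part within the strip where the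
    principal branch \<open>Ln\<close> inverts \<open>exp\<close>.\<close>
  have "\<forall>\<^sub>F z :: complex in nhds 0. z \<in> ball 0 pi"
    by (intro eventually_nhds_in_open) auto
  thus ?thesis
  proof eventually_elim
    case (elim z)
    hence "\<bar>Im z\<bar> < pi"
      using abs_Im_le_cmod[of z] by simp
    thus ?case
      by (simp add: Z_def V_def)
  qed
qed

lemma eventually_V_Z: "\<forall>\<^sub>F v in nhds 0. V (Z v) = v"
  using eventually_near_minus_1 by eventually_elim (simp add: Z_def V_def)

theorem proposition4p1:
  shows "(\<forall>\<^sub>F z in nhds 0. Z (V z) = z) \<and> (\<forall>\<^sub>F v in nhds 0. V (Z v) = v)
    \<and> (\<forall>x. \<forall>\<^sub>F v in nhds 0. exp (x * Z v) = (1 + v) powr x)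
    \<and> (\<exists>!p. egf_of_polys (\<lambda>x v. exp (x * Z v)) p)
    \<and> (\<exists>!q. egf_of_polys (\<lambda>y z. exp (y * V z)) q)
    \<and> (\<forall>p. egf_of_polys (\<lambda>x v. exp (x * Z v)) p \<longrightarrow>
          (\<forall>n x. poly (p n) x = (\<Prod>j<n. x - of_nat j)
               \<and> poly (p n) x = (\<Sum>k\<le>n. of_int (stirling_first n k) * x ^ k)))
    \<and> (\<forall>q. egf_of_polys (\<lambda>y z. exp (y * V z)) q \<longrightarrow>
          (\<forall>n. (\<forall>y. poly (q n) y = (\<Sum>k\<le>n. of_nat (stirling_second n k) * y ^ k))
               \<and> q n = touchard n))"
proof (intro conjI)
  show "\<forall>\<^sub>F z in nhds 0. Z (V z) = z"
    by (rule eventually_Z_V)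
  show "\<forall>\<^sub>F v in nhds 0. V (Z v) = v"
    by (rule eventually_V_Z)
  show "\<forall>x. \<forall>\<^sub>F v in nhds 0. exp (x * Z v) = (1 + v) powr x"
    by (intro allI eventually_exp_Z)
  show "\<exists>!p. egf_of_polys (\<lambda>x v. exp (x * Z v)) p"
    using Z_egf_of_falling_factorials egf_of_polys_unique by blast
  show "\<exists>!q. egf_of_polys (\<lambda>y z. exp (y * V z)) q"
    using V_egf_of_touchard egf_of_polys_unique by blast
  show "\<forall>p. egf_of_polys (\<lambda>x v. exp (x * Z v)) p \<longrightarrow>
          (\<forall>n x. poly (p n) x = (\<Prod>j<n. x - of_nat j)
               \<and> poly (p n) x = (\<Sum>k\<le>n. of_int (stirling_first n k) * x ^ k))"
  proof (intro allI impI)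
    fix p n x assume "egf_of_polys (\<lambda>x v. exp (x * Z v)) p"
    \<comment> \<open>Uniqueness identifies an arbitrary solution \<open>p\<close> with the explicit
      falling factorials.\<close>
    hence "p = (\<lambda>n. \<Prod>j<n. [:- of_nat j, 1:])"
      using Z_egf_of_falling_factorials by (rule egf_of_polys_unique)
    thus "poly (p n) x = (\<Prod>j<n. x - of_nat j)
            \<and> poly (p n) x = (\<Sum>k\<le>n. of_int (stirling_first n k) * x ^ k)"
      by (simp add: sum_stirling_first poly_prod)
  qed
  show "\<forall>q. egf_of_polys (\<lambda>y z. exp (y * V z)) q \<longrightarrow>
          (\<forall>n. (\<forall>y. poly (q n) y = (\<Sum>k\<le>n. of_nat (stirling_second n k) * y ^ k))
               \<and> q n = touchard n)"
  proof (intro allI impI)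
    fix q n assume "egf_of_polys (\<lambda>y z. exp (y * V z)) q"
    hence "q = touchard"
      using V_egf_of_touchard by (rule egf_of_polys_unique)
    thus "(\<forall>y. poly (q n) y = (\<Sum>k\<le>n. of_nat (stirling_second n k) * y ^ k))
            \<and> q n = touchard n"
      by (simp add: touchard_def poly_sum poly_monom)
  qed
qed

end
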